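(* Let $g \geq 2$ be an integer. For every $i \in \{0,1,2,\ldots\}$ let $U_i$ be a proper subset of $\{0,1,\ldots,g-1\}$, and let $\mathcal{U} = (U_i)_{i=0}^{\infty}$. Assume: (i) the set $\mathcal{M} = \{m \in \mathbf{N} : U_{m-1} \neq \{1,2,\ldots,g-1\}\}$ is infinite; and (ii) there exist nonnegative real numbers $\alpha_0, \alpha_1, \ldots, \alpha_{g-1}$ such that, for all $m \in \mathbf{N}$ and $k \in \{0,1,\ldots,g-1\}$, \[ \#\{i \in \{0,1,\ldots,m-1\} : |U_i| = k\} = \alpha_k m + \varepsilon_k(m) \] with \[ \lim_{m\to\infty} \frac{\varepsilon_k(m)}{m} = 0 . \] Let $A_{g,\mathcal{U}}$ be the set of positive integers $n$ whose $g$-adic representation $n = \sum_{i=0}^{m-1} c_i g^i$ (with $c_i \in \{0,\ldots,g-1\}$ and $c_{m-1} \neq 0$) satisfies $c_i \notin U_i$ for all $i \in \{0,\ldots,m-1\}$. Then the Dirichlet series \[ F_{A_{g,\mathcal{U}}}(s) = \sum_{a \in A_{g,\mathcal{U}}} \frac{1}{a^s} \] has abscissa of convergence \[ \sigma_c = \frac{1}{\log g} \sum_{k=0}^{g-1} \alpha_k \log(g-k). \]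
   Context: $\mathbf{N} = \{1,2,3,\ldots\}$. Every positive integer $n$ has a unique $g$-adic representation $n=\sum_{i=0}^{m-1} c_i g^i$ with digits $c_i\in\{0,1,\ldots,g-1\}$ and leading digit $c_{m-1}\neq 0$, where $m$ is such that $g^{m-1}\le n\le g^m-1$. The abscissa of convergence of a Dirichlet series $\sum a^{-s}$ is the infimum of real $\sigma$ such that the series converges for $\Re(s)>\sigma$. *)

theory Defs
  imports "HOL-Analysis.Analysis"
begin

definition gadic_representation :: "nat \<Rightarrow> nat \<Rightarrow> nat \<Rightarrow> (nat \<Rightarrow> nat) \<Rightarrow> bool" where
  "gadic_representation g n m c \<longleftrightarrow>
     1 \<le> m \<and> (\<forall>i<m. c i < g) \<and> c (m - 1) \<noteq> 0 \<and> n = (\<Sum>i<m. c i * g ^ i)"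

(* For g >= 2 the length m and the digits c i (i < m) are determined by n, so it does
   not matter that the representation is quantified existentially. *)
definition digit_avoiding :: "nat \<Rightarrow> (nat \<Rightarrow> nat set) \<Rightarrow> nat set" where
  "digit_avoiding g U =
     {n. 0 < n \<and> (\<exists>m c. gadic_representation g n m c \<and> (\<forall>i<m. c i \<notin> U i))}"

(* Partial sums of the Dirichlet series of a, summed over n = 1, 2, 3, ... in this order;
   the value a 0 is ignored. *)
definition dirichlet_converges :: "(nat \<Rightarrow> complex) \<Rightarrow> complex \<Rightarrow> bool" where
  "dirichlet_converges a s \<longleftrightarrow> summable (\<lambda>n. a (Suc n) / of_nat (Suc n) powr s)"

(* Taken in the extended reals: a series that converges everywhere has abscissa -\<infinity>, and
   one that converges in no half-plane has abscissa \<infinity>. *)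
definition abscissa_of_convergence :: "(nat \<Rightarrow> complex) \<Rightarrow> ereal" where
  "abscissa_of_convergence a =
     Inf (ereal ` {\<sigma>. \<forall>s. Re s > \<sigma> \<longrightarrow> dirichlet_converges a s})"

(* The series of a ^ (-s) over all a in A, that is, with the indicator of A as coefficients. *)
definition set_abscissa :: "nat set \<Rightarrow> ereal" where
  "set_abscissa A = abscissa_of_convergence (indicator A)"

end

theory Submission
  imports Defs
begin

text \<open>
  Let \<open>P m\<close> be the number of admissible strings of \<open>m\<close> digits. Assumption (ii) says that
  \<open>ln (P m) / m\<close> tends to \<open>\<theta> * ln g\<close>, where \<open>\<theta>\<close> is the claimed abscissa. The admissible integers
  in \<open>[g ^ m, g ^ Suc m)\<close> number at most \<open>P (Suc m)\<close>, and at least \<open>P m\<close> whenever a nonzero leading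
  digit is available, which by (i) happens for infinitely many \<open>m\<close>. On this block \<open>n powr - \<sigma>\<close> is
  \<open>g powr (- m * \<sigma>)\<close> up to a constant factor, so the block sums are dominated by a geometric series
  when \<open>\<sigma> > \<theta>\<close> and are unbounded when \<open>\<sigma> < \<theta>\<close>.
\<close>

section \<open>Digit strings and blocks of integers of equal length\<close>

text \<open>Leading zeros are allowed, so the digits are chosen independently and the count is a
  product. Values stand in for strings; uniqueness of base \<open>g\<close> digits makes the two
  counts agree.\<close>

definition digit_strings :: "nat \<Rightarrow> (nat \<Rightarrow> nat set) \<Rightarrow> nat \<Rightarrow> nat set" where
  "digit_strings g U m = {\<Sum>i<m. c i * g ^ i | c. \<forall>i<m. c i < g \<and> c i \<notin> U i}"

text \<open>For \<open>g \<ge> 2\<close>, these are the members of \<open>digit_avoiding g U\<close>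
  with \<open>m + 1\<close> digits: \<open>m\<close> is the exponent of the leading digit, not the
  length.\<close>

definition digit_block :: "nat \<Rightarrow> (nat \<Rightarrow> nat set) \<Rightarrow> nat \<Rightarrow> nat set" where
  "digit_block g U m =
     (\<lambda>(x, d). x + d * g ^ m) ` (digit_strings g U m \<times> ({0..<g} - U m - {0}))"

lemma digit_strings_0 [simp]: "digit_strings g U 0 = {0}"
  by (simp add: digit_strings_def)

lemma digit_strings_Suc:
  "digit_strings g U (Suc m) =
     (\<lambda>(x, d). x + d * g ^ m) ` (digit_strings g U m \<times> ({0..<g} - U m))"
proof (intro equalityI subsetI)
  fix n assume "n \<in> digit_strings g U (Suc m)"
  then show "n \<in> (\<lambda>(x, d). x + d * g ^ m) ` (digit_strings g U m \<times> ({0..<g} - U m))"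
    by (fastforce simp: digit_strings_def)
next
  fix n assume "n \<in> (\<lambda>(x, d). x + d * g ^ m) ` (digit_strings g U m \<times> ({0..<g} - U m))"
  then obtain c d where c: "\<forall>i<m. c i < g \<and> c i \<notin> U i" and d: "d < g" "d \<notin> U m"
    and n: "n = (\<Sum>i<m. c i * g ^ i) + d * g ^ m"
    by (auto simp: digit_strings_def)
  have "n = (\<Sum>i<Suc m. (c(m := d)) i * g ^ i)"
    by (simp add: n)
  with c d show "n \<in> digit_strings g U (Suc m)"
    unfolding digit_strings_def by (auto intro!: exI[of _ "c(m := d)"] simp: less_Suc_eq)
qed

lemma digit_strings_less: "x \<in> digit_strings g U m \<Longrightarrow> x < g ^ m"
proof (induction m arbitrary: x)
  case (Suc m)
  then obtain y d where y: "y \<in> digit_strings g U m" and d: "d < g" and x: "x = y + d * g ^ m"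
    by (auto simp: digit_strings_Suc)
  have "x < Suc d * g ^ m"
    using Suc.IH[OF y] by (simp add: x)
  also have "\<dots> \<le> g * g ^ m"
    using d by (intro mult_le_mono1) simp
  finally show ?case by simp
qed simp

lemma finite_digit_strings: "finite (digit_strings g U m)"
  by (induction m) (simp_all add: digit_strings_Suc)

text \<open>As \<open>x < g ^ m\<close>, \<open>x\<close> and \<open>d\<close> are the remainder and
  quotient on division by \<open>g ^ m\<close>. The set \<open>D\<close> is left arbitrary to serve
  both strings and blocks.\<close>

lemma inj_on_prepend_digit:
  "inj_on (\<lambda>(x, d). x + d * g ^ m) (digit_strings g U m \<times> D)"
proof (intro inj_onI, clarsimp)
  fix x d y e :: nat
  assume x: "x \<in> digit_strings g U m" and y: "y \<in> digit_strings g U m"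
    and eq: "x + d * g ^ m = y + e * g ^ m"
  note less = digit_strings_less[OF x] digit_strings_less[OF y]
  have "x = (x + d * g ^ m) mod g ^ m" "y = (y + e * g ^ m) mod g ^ m"
    using less by simp_all
  then have "x = y" using eq by simp
  moreover have "g ^ m \<noteq> 0" using less by linarith
  ultimately show "x = y \<and> d = e" using eq by auto
qed

lemma card_digit_strings_Suc:
  "card (digit_strings g U (Suc m)) = card (digit_strings g U m) * card ({0..<g} - U m)"
  by (simp add: digit_strings_Suc card_image inj_on_prepend_digit card_cartesian_product)

text \<open>Only the cardinalities of the \<open>U i\<close> enter, which are the data that the
  frequency hypothesis controls.\<close>

lemma card_digit_strings:
  assumes "\<And>i. U i \<subset> {0..<g}"
  shows "card (digit_strings g U m) = (\<Prod>i<m. g - card (U i))"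
proof (induction m)
  case (Suc m)
  have "finite (U m)" using assms[of m] finite_subset by blast
  then have "card ({0..<g} - U m) = g - card (U m)"
    using assms[of m] by (subst card_Diff_subset) auto
  with Suc show ?case by (simp add: card_digit_strings_Suc)
qed simp

lemma finite_digit_block: "finite (digit_block g U m)"
  by (simp add: digit_block_def finite_digit_strings)

lemma card_digit_block:
  "card (digit_block g U m) = card (digit_strings g U m) * card ({0..<g} - U m - {0})"
  by (simp add: digit_block_def card_image inj_on_prepend_digit card_cartesian_product)

lemma digit_block_subset_digit_strings: "digit_block g U m \<subseteq> digit_strings g U (Suc m)"
  by (auto simp: digit_block_def digit_strings_Suc)

lemma digit_block_bounds:
  assumes "n \<in> digit_block g U m"
  shows "g ^ m \<le> n" and "n < g ^ Suc m"
proof -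
  obtain x d where "d > 0" and n: "n = x + d * g ^ m"
    using assms by (auto simp: digit_block_def)
  then have "1 * g ^ m \<le> d * g ^ m" by (intro mult_le_mono1) simp
  then show "g ^ m \<le> n" unfolding n by linarith
  show "n < g ^ Suc m"
    using assms digit_block_subset_digit_strings digit_strings_less by blast
qed

lemma disjoint_digit_blocks:
  assumes "g \<ge> 2" "m \<noteq> k"
  shows "digit_block g U m \<inter> digit_block g U k = {}"
proof -
  have False if "n \<in> digit_block g U i" "n \<in> digit_block g U j" "i < j" for n i j
  proof -
    have "g ^ Suc i \<le> g ^ j" using that assms by (intro power_increasing) auto
    then show False using digit_block_bounds[OF that(1)] digit_block_bounds[OF that(2)] by simp
  qed
  then show ?thesis using assms(2) by (metis disjoint_iff linorder_neqE_nat)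
qed

text \<open>Sorting by the position of the leading digit; since the blocks are disjoint, sums over
  the set split into block sums.\<close>

lemma digit_avoiding_eq_UN:
  assumes "g \<ge> 2"
  shows "digit_avoiding g U = (\<Union>m. digit_block g U m)"
proof (intro equalityI subsetI)
  fix n assume "n \<in> digit_avoiding g U"
  then obtain m c where m: "1 \<le> m" and c: "\<forall>i<m. c i < g" "c (m - 1) \<noteq> 0" "\<forall>i<m. c i \<notin> U i"
    and n: "n = (\<Sum>i<m. c i * g ^ i)"
    by (auto simp: digit_avoiding_def gadic_representation_def)
  obtain k where k: "m = Suc k" using m by (cases m) auto
  have "(\<Sum>i<k. c i * g ^ i) \<in> digit_strings g U k"
    using c k by (auto simp: digit_strings_def)
  moreover have "c k \<in> {0..<g} - U k - {0}"
    using c k by auto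
  ultimately have "n \<in> digit_block g U k"
    unfolding digit_block_def
    by (intro image_eqI[of _ _ "(\<Sum>i<k. c i * g ^ i, c k)"]) (auto simp: n k)
  then show "n \<in> (\<Union>m. digit_block g U m)" by blast
next
  fix n assume "n \<in> (\<Union>m. digit_block g U m)"
  then obtain m where nm: "n \<in> digit_block g U m" by blast
  then obtain p where p: "p \<in> digit_strings g U m \<times> ({0..<g} - U m - {0})"
    "n = (\<lambda>(x, d). x + d * g ^ m) p"
    unfolding digit_block_def by (rule imageE)
  obtain x d where "p = (x, d)" by (cases p)
  with p have x: "x \<in> digit_strings g U m" and d: "d < g" "d \<notin> U m" "d \<noteq> 0"
    and nx: "n = x + d * g ^ m"
    by simp_all
  from x obtain c where c: "\<forall>i<m. c i < g \<and> c i \<notin> U i" and "x = (\<Sum>i<m. c i * g ^ i)"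
    by (auto simp: digit_strings_def)
  with nx have n: "n = (\<Sum>i<m. c i * g ^ i) + d * g ^ m" by simp
  have "gadic_representation g n (Suc m) (c(m := d))"
    using c d by (auto simp: gadic_representation_def n)
  moreover have "\<forall>i<Suc m. (c(m := d)) i \<notin> U i"
    using c d by auto
  moreover have "0 < n"
    using order_less_le_trans[OF _ digit_block_bounds(1)[OF nm]] assms by simp
  ultimately show "n \<in> digit_avoiding g U"
    unfolding digit_avoiding_def by blast
qed

section \<open>Size of the terms on one block\<close>

text \<open>The function is monotone in \<open>x\<close>, so its extremes lie at the two ends of the
  interval. Which end is larger depends on the sign of \<open>s\<close>;
  \<open>\<bar>s\<bar>\<close> gives one formula for both signs. Negative \<open>s\<close> matters:
  the abscissa can be 0, and divergence is then tested at negative exponents.\<close>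

lemma powr_minus_bounds:
  fixes b x s :: real
  assumes "b > 1" "b ^ m \<le> x" "x \<le> b ^ Suc m"
  shows "x powr - s \<le> b powr (\<bar>s\<bar> - real (Suc m) * s)"
    and "b powr (- \<bar>s\<bar> - real m * s) \<le> x powr - s"
proof -
  have x: "x > 0" using assms by (meson order_less_le_trans zero_less_power less_trans zero_less_one)
  have "ln (b ^ m) \<le> ln x" "ln x \<le> ln (b ^ Suc m)"
    using assms x by simp_all
  then have lo: "real m * ln b \<le> ln x" and up: "ln x \<le> real (Suc m) * ln b"
    using assms(1) by (simp_all only: ln_realpow)
  have b: "ln b > 0" using assms by simp
  have "s * ln x \<ge> (real (Suc m) * s - \<bar>s\<bar>) * ln b \<and> s * ln x \<le> (\<bar>s\<bar> + real m * s) * ln b"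
  proof (cases "s \<ge> 0")
    case True
    have "s * (real m * ln b) \<le> s * ln x" "s * ln x \<le> s * (real (Suc m) * ln b)"
      using True lo up by (intro mult_left_mono; simp)+
    then show ?thesis using True by (simp add: algebra_simps)
  next
    case False
    have "s * (real m * ln b) \<ge> s * ln x" "s * ln x \<ge> s * (real (Suc m) * ln b)"
      using False lo up by (intro mult_left_mono_neg; simp)+
    \<comment> \<open>For negative \<open>s\<close> the claimed bounds differ from the endpoint
      values by \<open>s * ln b\<close>, a slack of the right sign.\<close>
    moreover have "s * ln b \<le> 0" using False b by (simp add: mult_le_0_iff)
    moreover have "(real (Suc m) * s - \<bar>s\<bar>) * ln b = s * (real (Suc m) * ln b) + s * ln b"
      "(\<bar>s\<bar> + real m * s) * ln b = s * (real m * ln b) - s * ln b"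
      using False by (simp_all add: algebra_simps)
    ultimately show ?thesis by linarith
  qed
  then show "x powr - s \<le> b powr (\<bar>s\<bar> - real (Suc m) * s)"
    and "b powr (- \<bar>s\<bar> - real m * s) \<le> x powr - s"
    using x assms(1) by (simp_all add: powr_def algebra_simps)
qed

text \<open>Number of terms times a bound for each term. From above, the block lies among all
  strings of length \<open>Suc m\<close>; from below, one admissible nonzero leading digit already
  yields an element for every string of length \<open>m\<close>.\<close>

lemma sum_digit_block_bounds:
  fixes s :: real
  assumes "g \<ge> 2"
  shows "(\<Sum>n\<in>digit_block g U m. real n powr - s)
           \<le> real (card (digit_strings g U (Suc m))) * real g powr (\<bar>s\<bar> - real (Suc m) * s)"
    and "{0..<g} - U m - {0} \<noteq> {} \<Longrightarrow>
           real (card (digit_strings g U m)) * real g powr (- \<bar>s\<bar> - real m * s)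
             \<le> (\<Sum>n\<in>digit_block g U m. real n powr - s)"
proof -
  have g: "real g > 1" using assms by simp
  have bd: "real g ^ m \<le> real n" "real n \<le> real g ^ Suc m" if "n \<in> digit_block g U m" for n
    using digit_block_bounds[OF that] by (simp_all flip: of_nat_power of_nat_mult)
  note pb = powr_minus_bounds[OF g bd]
  have "(\<Sum>n\<in>digit_block g U m. real n powr - s)
          \<le> real (card (digit_block g U m)) * real g powr (\<bar>s\<bar> - real (Suc m) * s)"
    by (rule sum_bounded_above) (rule pb(1))
  also have "\<dots> \<le> real (card (digit_strings g U (Suc m))) * real g powr (\<bar>s\<bar> - real (Suc m) * s)"
    by (intro mult_right_mono) (simp_all add: card_mono digit_block_subset_digit_strings finite_digit_strings)
  finally show "(\<Sum>n\<in>digit_block g U m. real n powr - s)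
      \<le> real (card (digit_strings g U (Suc m))) * real g powr (\<bar>s\<bar> - real (Suc m) * s)" .
  assume "{0..<g} - U m - {0} \<noteq> {}"
  then have "card ({0..<g} - U m - {0}) \<noteq> 0"
    by (subst card_eq_0_iff) simp
  then have "card (digit_strings g U m) \<le> card (digit_block g U m)"
    unfolding card_digit_block by (cases "card ({0..<g} - U m - {0})") simp_all
  then have "real (card (digit_strings g U m)) * real g powr (- \<bar>s\<bar> - real m * s)
               \<le> real (card (digit_block g U m)) * real g powr (- \<bar>s\<bar> - real m * s)"
    by (intro mult_right_mono) simp_all
  also have "\<dots> \<le> (\<Sum>n\<in>digit_block g U m. real n powr - s)"
    by (rule sum_bounded_below) (rule pb(2))
  finally show "real (card (digit_strings g U m)) * real g powr (- \<bar>s\<bar> - real m * s)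
      \<le> (\<Sum>n\<in>digit_block g U m. real n powr - s)" .
qed

section \<open>Exponential growth rate of the number of digit strings\<close>

lemma ln_prod_by_card:
  fixes f :: "nat \<Rightarrow> nat" and w :: "nat \<Rightarrow> real"
  assumes "\<And>i. f i < g" "\<And>k. k < g \<Longrightarrow> w k > 0"
  shows "ln (\<Prod>i<m. w (f i)) = (\<Sum>k<g. real (card {i. i < m \<and> f i = k}) * ln (w k))"
proof -
  have "ln (\<Prod>i<m. w (f i)) = (\<Sum>i<m. ln (w (f i)))"
    using assms(2)[OF assms(1)] by (intro ln_prod) (auto simp: less_le)
  also have "\<dots> = (\<Sum>k<g. \<Sum>i\<in>{i\<in>{..<m}. f i = k}. ln (w (f i)))"
    using assms by (intro sum.group[symmetric]) auto
  also have "\<dots> = (\<Sum>k<g. real (card {i. i < m \<and> f i = k}) * ln (w k))"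
    by (intro sum.cong) auto
  finally show ?thesis .
qed

text \<open>The quotient is an average of the numbers \<open>ln (g - k)\<close>, weighted by the
  frequency of \<open>card (U i) = k\<close> among the first \<open>m\<close> indices.\<close>

lemma tendsto_ln_card_digit_strings:
  fixes \<alpha> :: "nat \<Rightarrow> real"
  assumes U: "\<And>i. U i \<subset> {0..<g}"
    and freq: "\<And>k. k < g \<Longrightarrow> (\<lambda>m. real (card {i. i < m \<and> card (U i) = k}) / real m) \<longlonglongrightarrow> \<alpha> k"
  shows "(\<lambda>m. ln (real (card (digit_strings g U m))) / real m)
           \<longlonglongrightarrow> (\<Sum>k<g. \<alpha> k * ln (real g - real k))"
proof -
  \<comment> \<open>Properness of \<open>U i\<close> keeps the arguments of the logarithms positive
    and lets truncated subtraction agree with real subtraction.\<close>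
  have cardU: "card (U i) < g" for i
    using psubset_card_mono[OF _ U[of i]] by simp
  have "ln (real (card (digit_strings g U m))) =
      (\<Sum>k<g. real (card {i. i < m \<and> card (U i) = k}) * ln (real g - real k))" for m
  proof -
    have "real (card (digit_strings g U m)) = (\<Prod>i<m. real g - real (card (U i)))"
      using cardU by (simp add: card_digit_strings[OF U] of_nat_diff less_imp_le)
    also have "ln \<dots> = (\<Sum>k<g. real (card {i. i < m \<and> card (U i) = k}) * ln (real g - real k))"
      using cardU by (intro ln_prod_by_card[where w = "\<lambda>k. real g - real k"]) auto
    finally show ?thesis .
  qed
  moreover have "(\<lambda>m. \<Sum>k<g. real (card {i. i < m \<and> card (U i) = k}) / real m * ln (real g - real k))
      \<longlonglongrightarrow> (\<Sum>k<g. \<alpha> k * ln (real g - real k))"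
    using freq by (intro tendsto_sum tendsto_mult tendsto_const) auto
  ultimately show ?thesis
    by (simp add: sum_divide_distrib)
qed

text \<open>Root test in logarithmic form: the \<open>m\<close>-th root of the term tends to
  \<open>exp (L - l) < 1\<close>.\<close>

lemma summable_exp_growth:
  fixes P :: "nat \<Rightarrow> real"
  assumes pos: "\<And>m. P m > 0" and lim: "(\<lambda>m. ln (P m) / real m) \<longlonglongrightarrow> L" and "L < l"
  shows "summable (\<lambda>m. P m * exp (- real m * l))"
proof -
  \<comment> \<open>Any value strictly between \<open>L\<close> and \<open>l\<close> gives a
    dominating geometric series of ratio \<open>exp (l' - l) < 1\<close>.\<close>
  define l' where "l' = (L + l) / 2"
  have l': "L < l'" "l' < l" using assms(3) by (auto simp: l'_def)
  have "eventually (\<lambda>m. ln (P m) / real m < l') sequentially"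
    using order_tendstoD(2)[OF lim l'(1)] .
  then have "eventually (\<lambda>m. norm (P m * exp (- real m * l)) \<le> exp (l' - l) ^ m) sequentially"
    \<comment> \<open>At \<open>m = 0\<close> the quotient is 0 by convention and says nothing about
      \<open>P 0\<close>.\<close>
    using eventually_gt_at_top[of 0]
  proof eventually_elim
    case (elim m)
    then have "ln (P m) \<le> real m * l'" by (simp add: field_simps)
    then have "P m \<le> exp (real m * l')" using pos[of m] by (metis exp_le_cancel_iff exp_ln)
    then have "P m * exp (- real m * l) \<le> exp (real m * l') * exp (- real m * l)"
      by (intro mult_right_mono) auto
    also have "\<dots> = exp (l' - l) ^ m"
      by (simp add: exp_of_nat_mult[symmetric] exp_add[symmetric] algebra_simps)
    finally show ?case using pos[of m] by simp
  qed
  moreover have "summable (\<lambda>m. exp (l' - l) ^ m)"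
    using l' by (intro summable_geometric) auto
  ultimately show ?thesis by (rule summable_comparison_test_ev)
qed

text \<open>The exponent is \<open>m\<close> times a quantity tending to \<open>L - l > 0\<close>.
  Divergence to infinity, rather than mere unboundedness, is what carries over to the infinitely
  many \<open>m\<close> with a usable leading digit.\<close>

lemma filterlim_exp_growth:
  fixes P :: "nat \<Rightarrow> real"
  assumes pos: "\<And>m. P m > 0" and lim: "(\<lambda>m. ln (P m) / real m) \<longlonglongrightarrow> L" and "l < L"
  shows "filterlim (\<lambda>m. P m * exp (- real m * l)) at_top sequentially"
proof -
  have "filterlim (\<lambda>m. (ln (P m) / real m - l) * real m) at_top sequentially"
    using assms(3) by (intro filterlim_tendsto_pos_mult_at_top[of _ "L - l"] tendsto_diff lim
        tendsto_const filterlim_real_sequentially) auto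
  then have "filterlim (\<lambda>m. exp ((ln (P m) / real m - l) * real m)) at_top sequentially"
    by (rule filterlim_compose[OF exp_at_top])
  moreover have "eventually (\<lambda>m. exp ((ln (P m) / real m - l) * real m) = P m * exp (- real m * l))
      sequentially"
    using eventually_gt_at_top[of 0]
  proof eventually_elim
    case (elim m)
    then have "(ln (P m) / real m - l) * real m = ln (P m) + (- real m * l)"
      by (simp add: field_simps)
    then show ?case using pos[of m] by (simp only: exp_add exp_ln)
  qed
  ultimately show ?thesis
    by (rule filterlim_mono_eventually[OF _ order_refl order_refl])
qed

section \<open>Dirichlet series with indicator coefficients\<close>

text \<open>Absolute convergence depends on \<open>Re s\<close> only, so complex arguments reduce to
  real ones.\<close>

lemma norm_dirichlet_indicator:
  "norm (indicator A (Suc n) / of_nat (Suc n) powr s :: complex)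
     = indicator A (Suc n) * real (Suc n) powr - Re s"
proof -
  have "norm (of_nat (Suc n) powr s) = real (Suc n) powr Re s"
    by (subst norm_powr_real_powr) simp_all
  then show ?thesis
    by (simp add: norm_divide powr_minus_divide indicator_def del: of_nat_Suc)
qed

text \<open>At a real argument the terms are nonnegative reals; divergence is tested there.\<close>

lemma dirichlet_converges_indicator_of_real:
  "dirichlet_converges (indicator A) (of_real \<sigma>) \<longleftrightarrow>
     summable (\<lambda>n. indicator A (Suc n) * real (Suc n) powr - \<sigma>)"
proof -
  have "indicator A (Suc n) / of_nat (Suc n) powr of_real \<sigma> =
      (of_real (indicator A (Suc n) * real (Suc n) powr - \<sigma>) :: complex)" for n
    by (simp add: indicator_def powr_minus divide_inverse powr_of_real[symmetric] del: of_nat_Suc)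
  then show ?thesis
    unfolding dirichlet_converges_def by (simp only: summable_complex_of_real)
qed

lemma sum_indicator_Suc:
  "(\<Sum>n<N. indicator A (Suc n) * f (Suc n)) = (\<Sum>n\<in>A \<inter> {1..N}. f n :: real)"
proof -
  have "(\<Sum>n<N. indicator A (Suc n) * f (Suc n)) = (\<Sum>n\<in>{1..N}. indicator A n * f n)"
    by (rule sum.reindex_bij_witness[of _ "\<lambda>n. n - 1" Suc]) auto
  also have "\<dots> = (\<Sum>n\<in>A \<inter> {1..N}. f n)"
    by (simp add: indicator_def if_distrib sum.If_cases Int_commute cong: if_cong)
  finally show ?thesis .
qed

theorem theorem1:
  fixes g :: nat
    and U :: "nat \<Rightarrow> nat set"
    and \<alpha> :: "nat \<Rightarrow> real"
    and \<epsilon> :: "nat \<Rightarrow> nat \<Rightarrow> real"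
  assumes "g \<ge> 2"
    and "\<And>i. U i \<subset> {0..<g}"
    and "infinite {m. m \<ge> 1 \<and> U (m - 1) \<noteq> {1..<g}}"
    and "\<And>k. k < g \<Longrightarrow> \<alpha> k \<ge> 0"
    and "\<And>m k. m \<ge> 1 \<Longrightarrow> k < g \<Longrightarrow>
           real (card {i. i < m \<and> card (U i) = k}) = \<alpha> k * real m + \<epsilon> k m"
    and "\<And>k. k < g \<Longrightarrow> (\<lambda>m. \<epsilon> k m / real m) \<longlonglongrightarrow> 0"
  shows "set_abscissa (digit_avoiding g U) =
           ereal (1 / ln (real g) * (\<Sum>k<g. \<alpha> k * ln (real g - real k)))"
proof -
  define P where "P m = real (card (digit_strings g U m))" for m
  \<comment> \<open>The claimed abscissa times \<open>ln g\<close>.\<close>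
  define L where "L = (\<Sum>k<g. \<alpha> k * ln (real g - real k))"
  define A where "A = digit_avoiding g U"
  have lng: "ln (real g) > 0" using assms(1) by simp
  have cardU: "card (U i) < g" for i
    using psubset_card_mono[OF _ assms(2)[of i]] by simp
  have Ppos: "P m > 0" for m
    unfolding P_def card_digit_strings[OF assms(2)] of_nat_0_less_iff
    using cardU by (intro prod_pos) simp
  have lim: "(\<lambda>m. ln (P m) / real m) \<longlonglongrightarrow> L"
    unfolding P_def L_def
  proof (rule tendsto_ln_card_digit_strings[OF assms(2)])
    fix k assume k: "k < g"
    have "(\<lambda>m. \<alpha> k + \<epsilon> k m / real m) \<longlonglongrightarrow> \<alpha> k + 0"
      by (intro tendsto_add tendsto_const assms(6) k)
    moreover have "eventually (\<lambda>m. \<alpha> k + \<epsilon> k m / real m =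
        real (card {i. i < m \<and> card (U i) = k}) / real m) sequentially"
      using eventually_ge_at_top[of 1]
    proof eventually_elim
      case (elim m)
      then show ?case by (simp add: assms(5)[OF elim k] add_divide_distrib)
    qed
    ultimately show "(\<lambda>m. real (card {i. i < m \<and> card (U i) = k}) / real m) \<longlonglongrightarrow> \<alpha> k"
      by (simp add: tendsto_cong)
  qed
  have A_eq: "A = (\<Union>m. digit_block g U m)"
    unfolding A_def by (rule digit_avoiding_eq_UN[OF assms(1)])
  \<comment> \<open>Brings the block bounds into the form of the growth lemmas, with
    \<open>l = \<sigma> * ln g\<close>.\<close>
  have powr_split: "real g powr (c - real m * \<sigma>) = real g powr c * exp (- real m * (\<sigma> * ln (real g)))"
    for c m \<sigma>
    using assms(1) by (simp add: powr_def exp_add[symmetric] algebra_simps)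

  \<comment> \<open>Absolute convergence to the right of the abscissa\<close>
  have conv: "dirichlet_converges (indicator A) s" if s: "Re s > L / ln (real g)" for s
  proof -
    define \<sigma> where "\<sigma> = Re s"
    define b where "b m = P m * exp (- real m * (\<sigma> * ln (real g)))" for m
    have "L < \<sigma> * ln (real g)" using s lng by (simp add: \<sigma>_def field_simps)
    then have b: "summable b"
      unfolding b_def by (rule summable_exp_growth[OF Ppos lim])
    have b0: "b m \<ge> 0" for m using Ppos[of m] by (simp add: b_def)
    have "(\<Sum>n<N. indicator A (Suc n) * real (Suc n) powr - \<sigma>) \<le> real g powr \<bar>\<sigma>\<bar> * suminf b" for N
    proof -
      \<comment> \<open>A crude cover suffices: an element \<open>n \<le> N\<close> of block
        \<open>m\<close> satisfies \<open>m < g ^ m \<le> n \<le> N\<close>.\<close>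
      have sub: "A \<inter> {1..N} \<subseteq> (\<Union>m<N. digit_block g U m)"
      proof
        fix n assume n: "n \<in> A \<inter> {1..N}"
        then obtain m where m: "n \<in> digit_block g U m" by (auto simp: A_eq)
        have "m < g ^ m" using assms(1) by (simp add: power_gt_expt)
        also have "\<dots> \<le> N" using digit_block_bounds(1)[OF m] n by simp
        finally show "n \<in> (\<Union>m<N. digit_block g U m)" using m by blast
      qed
      have "(\<Sum>n<N. indicator A (Suc n) * real (Suc n) powr - \<sigma>) = (\<Sum>n\<in>A \<inter> {1..N}. real n powr - \<sigma>)"
        by (rule sum_indicator_Suc)
      also have "\<dots> \<le> (\<Sum>n\<in>(\<Union>m<N. digit_block g U m). real n powr - \<sigma>)"
        using sub by (intro sum_mono2) (auto simp: finite_digit_block)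
      also have "\<dots> = (\<Sum>m<N. \<Sum>n\<in>digit_block g U m. real n powr - \<sigma>)"
        using disjoint_digit_blocks[OF assms(1)]
        by (intro sum.UNION_disjoint) (auto simp: finite_digit_block)
      \<comment> \<open>The index shifts by one because block \<open>m\<close> is compared with
        strings of length \<open>Suc m\<close>.\<close>
      also have "\<dots> \<le> (\<Sum>m<N. real g powr \<bar>\<sigma>\<bar> * b (Suc m))"
      proof (rule sum_mono)
        fix m
        show "(\<Sum>n\<in>digit_block g U m. real n powr - \<sigma>) \<le> real g powr \<bar>\<sigma>\<bar> * b (Suc m)"
          using sum_digit_block_bounds(1)[OF assms(1), where U = U and m = m and s = \<sigma>]
          unfolding b_def P_def powr_split by (simp only: mult_ac)
      qed
      also have "\<dots> = real g powr \<bar>\<sigma>\<bar> * (\<Sum>m\<in>Suc ` {..<N}. b m)"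
        by (simp add: sum_distrib_left sum.reindex)
      also have "\<dots> \<le> real g powr \<bar>\<sigma>\<bar> * suminf b"
        by (intro mult_left_mono sum_le_suminf b) (auto simp: b0)
      finally show ?thesis .
    qed
    then have "summable (\<lambda>n. indicator A (Suc n) * real (Suc n) powr - \<sigma>)"
      by (intro summableI_nonneg_bounded) (auto simp: indicator_def)
    then have "summable (\<lambda>n. norm (indicator A (Suc n) / of_nat (Suc n) powr s :: complex))"
      by (simp only: norm_dirichlet_indicator \<sigma>_def)
    then show ?thesis
      unfolding dirichlet_converges_def by (rule summable_norm_cancel)
  qed

  \<comment> \<open>Divergence at real points to the left\<close>
  have div: "\<not> dirichlet_converges (indicator A) (of_real \<sigma>)" if \<sigma>: "\<sigma> < L / ln (real g)" for \<sigma>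
  proof
    assume "dirichlet_converges (indicator A) (of_real \<sigma>)"
    then have summ: "summable (\<lambda>n. indicator A (Suc n) * real (Suc n) powr - \<sigma>)" (is "summable ?f")
      by (simp only: dirichlet_converges_indicator_of_real)
    have "\<sigma> * ln (real g) < L" using \<sigma> lng by (simp add: field_simps)
    then have "filterlim (\<lambda>m. P m * exp (- real m * (\<sigma> * ln (real g)))) at_top sequentially"
      by (rule filterlim_exp_growth[OF Ppos lim])
    then have "filterlim (\<lambda>m. real g powr - \<bar>\<sigma>\<bar> * (P m * exp (- real m * (\<sigma> * ln (real g)))))
        at_top sequentially"
      using assms(1) by (intro filterlim_tendsto_pos_mult_at_top[OF tendsto_const]) auto
    then have "eventually (\<lambda>m. real g powr - \<bar>\<sigma>\<bar> * (P m * exp (- real m * (\<sigma> * ln (real g)))) > suminf ?f)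
        sequentially"
      by (simp only: filterlim_at_top_dense)
    \<comment> \<open>From \<open>K\<close> on, the lower bound for a single usable block exceeds
      the sum of the whole series.\<close>
    then obtain K where K: "suminf ?f < real g powr - \<bar>\<sigma>\<bar> * (P m * exp (- real m * (\<sigma> * ln (real g))))"
      if "m \<ge> K" for m
      by (auto simp: eventually_sequentially)
    \<comment> \<open>Here \<open>m'\<close> is a length and \<open>m' - 1\<close> the leading
      position; the strict \<open>m' > K\<close> ensures \<open>m' - 1 \<ge> K\<close>.\<close>
    obtain m' where m': "m' > K" "m' \<ge> 1" "U (m' - 1) \<noteq> {1..<g}"
      using assms(3) unfolding infinite_nat_iff_unbounded by blast
    define m where "m = m' - 1"
    have m: "m \<ge> K" "U m \<noteq> {1..<g}"
      using m' by (simp_all add: m_def)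
    \<comment> \<open>If every nonzero digit were forbidden, \<open>U m\<close> would contain
      \<open>{1..<g}\<close>, and being proper it would equal that set.\<close>
    have ne: "{0..<g} - U m - {0} \<noteq> {}"
      using m(2) assms(2)[of m] by (fastforce simp: Suc_le_eq)
    have "real g powr - \<bar>\<sigma>\<bar> * (P m * exp (- real m * (\<sigma> * ln (real g))))
        \<le> (\<Sum>n\<in>digit_block g U m. real n powr - \<sigma>)"
      using sum_digit_block_bounds(2)[where U = U and m = m and s = \<sigma>, OF assms(1) ne]
      unfolding P_def powr_split by (simp only: mult_ac)
    also have "\<dots> \<le> (\<Sum>n\<in>A \<inter> {1..g ^ Suc m}. real n powr - \<sigma>)"
    proof (intro sum_mono2 subsetI)
      fix n assume n: "n \<in> digit_block g U m"
      have "g ^ m \<ge> 1" using assms(1) by simp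
      then show "n \<in> A \<inter> {1..g ^ Suc m}"
        using n digit_block_bounds[OF n] by (auto simp: A_eq)
    qed auto
    also have "\<dots> = (\<Sum>n<g ^ Suc m. ?f n)"
      by (rule sum_indicator_Suc[symmetric])
    also have "\<dots> \<le> suminf ?f"
      by (intro sum_le_suminf summ) (auto simp: indicator_def)
    finally show False using K[OF m(1)] by simp
  qed

  \<comment> \<open>Identification of the infimum\<close>
  have "Inf (ereal ` {\<sigma>. \<forall>s. Re s > \<sigma> \<longrightarrow> dirichlet_converges (indicator A) s}) = ereal (L / ln (real g))"
  proof (rule antisym)
    show "Inf (ereal ` {\<sigma>. \<forall>s. Re s > \<sigma> \<longrightarrow> dirichlet_converges (indicator A) s}) \<le> ereal (L / ln (real g))"
      using conv by (intro Inf_lower) auto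
    show "ereal (L / ln (real g)) \<le> Inf (ereal ` {\<sigma>. \<forall>s. Re s > \<sigma> \<longrightarrow> dirichlet_converges (indicator A) s})"
    proof (intro Inf_greatest, clarsimp)
      fix \<sigma> assume \<sigma>: "\<forall>s. \<sigma> < Re s \<longrightarrow> dirichlet_converges (indicator A) s"
      show "L / ln (real g) \<le> \<sigma>"
      proof (rule ccontr)
        \<comment> \<open>A real \<open>\<tau>\<close> strictly between the two would be a point of
          both convergence and divergence.\<close>
        assume "\<not> L / ln (real g) \<le> \<sigma>"
        then obtain \<tau> where "\<sigma> < \<tau>" "\<tau> < L / ln (real g)"
          using dense not_le by metis
        then show False using \<sigma> div[of \<tau>] by simp
      qed
    qed
  qed
  then show ?thesis
    by (simp add: set_abscissa_def abscissa_of_convergence_def A_def L_def)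
qed

end
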